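(* Let $\chi$ be a primitive Dirichlet character with conductor $f\in\mathbb{N}$, $(f,p)=1$. For $n\in\mathbb{Z}_+$, $r\in\mathbb{N}$ and $x\in\mathbb{Z}_p$, $$\beta_{n,\chi,q}^{(r)}(x)=\frac{1}{(1-q)^n}\sum_{l=0}^n\binom nl(-q^x)^l\sum_{a_1,\dots,a_r=0}^{f-1}\left(\prod_{i=1}^r\chi(a_i)\right)q^{l\sum_{i=1}^r a_i}\left(\frac{l}{[lf]_q}\right)^r$$ and $$\beta_{n,\chi,q}^{(r)}(x)=[f]_q^{\,n-r}\sum_{a_1,\dots,a_r=0}^{f-1}\left(\prod_{i=1}^r\chi(a_i)\right)\beta_{n,q^f}^{(r)}\left(\frac{x+a_1+\cdots+a_r}{f}\right).$$
   Context: $p$ is a fixed prime, $\mathbb{N}=\{1,2,\dots\}$, $\mathbb{Z}_+=\mathbb{N}\cup\{0\}$, and $\mathbb{C}_p$ is the completion of an algebraic closure of $\mathbb{Q}_p$, with $|p|_p=p^{-1}$. $q\in\mathbb{C}_p$ satisfies $|1-q|_p<1$ and is not a root of unity. For $x\in\mathbb{Z}_p$, $q^x=\sum_{k\ge0}\binom xk(q-1)^k$ and $[x]_q=\frac{1-q^x}{1-q}$; $0^0=1$. Dirichlet characters take values in $\mathbb{C}_p$. The $p$-adic $q$-integrals are $$\int_{\mathbb{Z}_p}g(x)\,d\mu_q(x)=\lim_{N\to\infty}\frac{1}{[p^N]_q}\sum_{x=0}^{p^N-1}g(x)q^x,\qquad \int_{X}g(x)\,d\mu_q(x)=\lim_{N\to\infty}\frac{1}{[fp^N]_q}\sum_{x=0}^{fp^N-1}g(x)q^x,$$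 where $X=\varprojlim_N\mathbb{Z}/fp^N\mathbb{Z}$ (when the limits exist); multiple integrals are iterated. The $q$-Bernoulli polynomials of order $r$ are $$\beta_{n,q}^{(r)}(x)=\int_{\mathbb{Z}_p}\cdots\int_{\mathbb{Z}_p}q^{-(x_1+\cdots+x_r)}[x+x_1+\cdots+x_r]_q^n\,d\mu_q(x_1)\cdots d\mu_q(x_r),$$ and $\beta_{n,q^f}^{(r)}$ is the same object with $q$ replaced by $q^f$. The generalized $q$-Bernoulli polynomials of order $r$ attached to $\chi$ are $$\beta_{n,\chi,q}^{(r)}(x)=\int_X\cdots\int_X\left(\prod_{i=1}^r\chi(x_i)\right)[x+x_1+\cdots+x_r]_q^n\,q^{-(x_1+\cdots+x_r)}\,d\mu_q(x_1)\cdots d\mu_q(x_r)$$ ($r$ integrals in each case). Convention: at $l=0$ the quotient $\frac{l}{[lf]_q}$ is read as its limiting value $\frac{q-1}{f\log q}$, where $\log$ is the $p$-adic logarithm. *)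

theory Defs
  imports "HOL-Analysis.Analysis" "HOL-Number_Theory.Cong"
    "HOL-Computational_Algebra.Polynomial"
begin

text \<open>
  The libraries have no $p$-adic fields, so \<open>\<complex>\<^sub>p\<close> is a type \<^typ>\<open>'c\<close>
  with an absolute value \<open>absp\<close> that induces its (complete) metric. The closure of the rationals
  is then \<open>\<rat>\<^sub>p\<close>, the completion of \<open>\<rat>\<close>; the elements algebraic over it are required to form an
  algebraic closure of \<open>\<rat>\<^sub>p\<close> and to be dense, i.e. \<^typ>\<open>'c\<close> is the completion of an
  algebraic closure of \<open>\<rat>\<^sub>p\<close>. These conditions fix the field and its absolute value up to
  isometric isomorphism.
\<close>

definition Qp :: "'c::{field_char_0, metric_space} set" where
  "Qp = closure (range of_rat)"

definition Qp_alg :: "'c::{field_char_0, metric_space} set" where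
  "Qp_alg = {z. \<exists>P. P \<noteq> 0 \<and> (\<forall>i. coeff P i \<in> Qp) \<and> poly P z = 0}"

locale padic_complex =
  fixes p :: nat and absp :: "'c::{field_char_0, complete_space} \<Rightarrow> real"
  assumes prime_p: "prime p"
    and dist_absp: "dist x y = absp (x - y)"
    and absp_mult: "absp (x * y) = absp x * absp y"
    and absp_ultrametric: "absp (x + y) \<le> max (absp x) (absp y)"
    and absp_p: "absp (of_nat p) = 1 / real p"
    and Qp_alg_closed: "degree P > 0 \<Longrightarrow> (\<And>i. coeff P i \<in> (Qp_alg :: 'c set)) \<Longrightarrow>
      \<exists>z\<in>Qp_alg. poly P z = 0"
    and Qp_alg_dense: "closure Qp_alg = (UNIV :: 'c set)"

definition Zp :: "('c::{field_char_0, metric_space} \<Rightarrow> real) \<Rightarrow> 'c set" where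
  "Zp absp = {x \<in> Qp. absp x \<le> 1}"

text \<open>
  \<open>qpow q x\<close> is \<open>q\<^sup>x\<close> for \<open>x \<in> \<int>\<^sub>p\<close>. For natural exponents it coincides with
  the power of the ring, by the binomial theorem; the latter is used where an exponent is given as a
  natural number.
\<close>

definition qpow :: "'c::{field_char_0, metric_space} \<Rightarrow> 'c \<Rightarrow> 'c" where
  "qpow q x = (\<Sum>k. (x gchoose k) * (q - 1) ^ k)"

definition qnum :: "'c::{field_char_0, metric_space} \<Rightarrow> 'c \<Rightarrow> 'c" where
  "qnum q x = (1 - qpow q x) / (1 - q)"

definition plog :: "'c::{field_char_0, metric_space} \<Rightarrow> 'c" where
  "plog z = (\<Sum>k. (-1) ^ k * (z - 1) ^ Suc k / of_nat (Suc k))"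

text \<open>\<open>l / [lf]\<^sub>q\<close>, with its limiting value at \<open>l = 0\<close>.\<close>

definition qquot :: "'c::{field_char_0, metric_space} \<Rightarrow> nat \<Rightarrow> nat \<Rightarrow> 'c" where
  "qquot q f l = (if l = 0 then (q - 1) / (of_nat f * plog q)
                  else of_nat l / qnum q (of_nat (l * f)))"

definition dirichlet_char :: "nat \<Rightarrow> (int \<Rightarrow> 'c::field) \<Rightarrow> bool" where
  "dirichlet_char f chi \<longleftrightarrow> f > 0 \<and> chi 1 = 1 \<and>
     (\<forall>a. chi (a + int f) = chi a) \<and>
     (\<forall>a b. chi (a * b) = chi a * chi b) \<and>
     (\<forall>a. chi a \<noteq> 0 \<longleftrightarrow> coprime a (int f))"

definition char_conductor :: "nat \<Rightarrow> (int \<Rightarrow> 'c::field) \<Rightarrow> nat" where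
  "char_conductor f chi =
     (LEAST d. d dvd f \<and> (\<forall>a. coprime a (int f) \<and> [a = 1] (mod int d) \<longrightarrow> chi a = 1))"

definition primitive_char :: "nat \<Rightarrow> (int \<Rightarrow> 'c::field) \<Rightarrow> bool" where
  "primitive_char f chi \<longleftrightarrow> dirichlet_char f chi \<and> char_conductor f chi = f"

text \<open>
  A point of \<open>X\<close>, the inverse limit of the \<open>\<int>/fp\<^sup>N\<int>\<close>, is the compatible sequence
  of its residues in \<open>{0..<fp\<^sup>N}\<close>. A character modulo \<open>f\<close> acts on \<open>X\<close> through the
  residue modulo \<open>f\<close>, and \<open>X_to_Zp\<close> is the canonical projection of \<open>X\<close> onto \<open>\<int>\<^sub>p\<close>.
\<close>

definition X_space :: "nat \<Rightarrow> nat \<Rightarrow> (nat \<Rightarrow> nat) set" where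
  "X_space p f = {s. \<forall>N. s N < f * p ^ N \<and> s (Suc N) mod (f * p ^ N) = s N}"

definition X_of_nat :: "nat \<Rightarrow> nat \<Rightarrow> nat \<Rightarrow> (nat \<Rightarrow> nat)" where
  "X_of_nat p f n = (\<lambda>N. n mod (f * p ^ N))"

definition X_to_Zp :: "(nat \<Rightarrow> nat) \<Rightarrow> 'c::{field_char_0, metric_space}" where
  "X_to_Zp s = lim (\<lambda>N. of_nat (s N))"

definition char_X :: "(int \<Rightarrow> 'c) \<Rightarrow> (nat \<Rightarrow> nat) \<Rightarrow> 'c" where
  "char_X chi s = chi (int (s 0))"

text \<open>The sequences whose limits are the integrals over \<open>\<int>\<^sub>p\<close> and over \<open>X\<close>.\<close>

definition Zp_sums :: "nat \<Rightarrow> 'c::{field_char_0, metric_space} \<Rightarrow> ('c \<Rightarrow> 'c) \<Rightarrow> nat \<Rightarrow> 'c" where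
  "Zp_sums p q g N = 1 / qnum q (of_nat (p ^ N)) * (\<Sum>x<p ^ N. g (of_nat x) * q ^ x)"

definition X_sums ::
  "nat \<Rightarrow> nat \<Rightarrow> 'c::{field_char_0, metric_space} \<Rightarrow> ((nat \<Rightarrow> nat) \<Rightarrow> 'c) \<Rightarrow> nat \<Rightarrow> 'c" where
  "X_sums p f q g N =
     1 / qnum q (of_nat (f * p ^ N)) * (\<Sum>x<f * p ^ N. g (X_of_nat p f x) * q ^ x)"

text \<open>
  The \<open>r\<close>-fold iterated integral of a function \<open>G\<close> of \<open>r\<close> variables (a list), where
  \<open>S g\<close> is the sequence whose limit is the integral of \<open>g\<close>. As \<^const>\<open>lim\<close> is unspecified on
  divergent sequences, existence is a separate predicate: every inner integral must
  exist for all values of the outer variables in the domain \<open>D\<close>, and so must the outermost one.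
\<close>

primrec iter_integral ::
  "(('a \<Rightarrow> 'c) \<Rightarrow> nat \<Rightarrow> 'c::metric_space) \<Rightarrow> nat \<Rightarrow> ('a list \<Rightarrow> 'c) \<Rightarrow> 'c" where
  "iter_integral S 0 G = G []"
| "iter_integral S (Suc r) G = lim (S (\<lambda>x. iter_integral S r (\<lambda>xs. G (x # xs))))"

primrec iter_integrable ::
  "'a set \<Rightarrow> (('a \<Rightarrow> 'c) \<Rightarrow> nat \<Rightarrow> 'c::metric_space) \<Rightarrow> nat \<Rightarrow> ('a list \<Rightarrow> 'c) \<Rightarrow> bool" where
  "iter_integrable D S 0 G \<longleftrightarrow> True"
| "iter_integrable D S (Suc r) G \<longleftrightarrow>
     (\<forall>x\<in>D. iter_integrable D S r (\<lambda>xs. G (x # xs))) \<and>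
     convergent (S (\<lambda>x. iter_integral S r (\<lambda>xs. G (x # xs))))"

definition qbern_integrand ::
  "'c::{field_char_0, metric_space} \<Rightarrow> nat \<Rightarrow> 'c \<Rightarrow> 'c list \<Rightarrow> 'c" where
  "qbern_integrand q n x xs = qpow q (- sum_list xs) * qnum q (x + sum_list xs) ^ n"

definition qbern :: "nat \<Rightarrow> nat \<Rightarrow> nat \<Rightarrow> 'c::{field_char_0, metric_space} \<Rightarrow> 'c \<Rightarrow> 'c" where
  "qbern p r n q x = iter_integral (Zp_sums p q) r (qbern_integrand q n x)"

definition qbern_exists ::
  "('c::{field_char_0, metric_space} \<Rightarrow> real) \<Rightarrow> nat \<Rightarrow> nat \<Rightarrow> nat \<Rightarrow> 'c \<Rightarrow> 'c \<Rightarrow> bool" where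
  "qbern_exists absp p r n q x \<longleftrightarrow>
     iter_integrable (Zp absp) (Zp_sums p q) r (qbern_integrand q n x)"

definition gen_qbern_integrand ::
  "(int \<Rightarrow> 'c) \<Rightarrow> 'c::{field_char_0, metric_space} \<Rightarrow> nat \<Rightarrow> 'c \<Rightarrow> (nat \<Rightarrow> nat) list \<Rightarrow> 'c" where
  "gen_qbern_integrand chi q n x ss =
     prod_list (map (char_X chi) ss) *
     qnum q (x + sum_list (map X_to_Zp ss)) ^ n * qpow q (- sum_list (map X_to_Zp ss))"

definition gen_qbern ::
  "nat \<Rightarrow> nat \<Rightarrow> (int \<Rightarrow> 'c) \<Rightarrow> nat \<Rightarrow> nat \<Rightarrow> 'c::{field_char_0, metric_space} \<Rightarrow> 'c \<Rightarrow> 'c" where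
  "gen_qbern p f chi r n q x = iter_integral (X_sums p f q) r (gen_qbern_integrand chi q n x)"

definition gen_qbern_exists ::
  "nat \<Rightarrow> nat \<Rightarrow> (int \<Rightarrow> 'c) \<Rightarrow> nat \<Rightarrow> nat \<Rightarrow> 'c::{field_char_0, metric_space} \<Rightarrow> 'c \<Rightarrow> bool" where
  "gen_qbern_exists p f chi r n q x \<longleftrightarrow>
     iter_integrable (X_space p f) (X_sums p f q) r (gen_qbern_integrand chi q n x)"

definition tuples :: "nat \<Rightarrow> nat \<Rightarrow> nat list set" where
  "tuples r f = {as. set as \<subseteq> {..<f} \<and> length as = r}"

end

theory Submission
  imports Defs
begin

text \<open>
  Expanding \<open>[x + y]\<^sub>q\<^sup>n = (1 - q\<^sup>x q\<^sup>y)\<^sup>n / (1 - q)\<^sup>n\<close> with \<open>y = x\<^sub>1 + \<dots> + x\<^sub>r\<close> by the binomial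
  theorem turns both integrands into finite sums, over \<open>l \<le> n\<close>, of products of functions of one
  variable: \<open>q\<^bsup>-y\<^esup> q\<^bsup>l y\<^esup>\<close> is the product of the \<open>q\<^bsup>-x\<^sub>i\<^esup> q\<^bsup>l x\<^sub>i\<^esup>\<close>. Each iterated integral is
  therefore the corresponding sum of \<open>r\<close>-th powers of integrals in one variable
  (\<open>iter_integral_sum_of_products\<close>). This also settles existence, including that of the inner
  integrals at arbitrary values of the outer variables.

  In one variable the factor \<open>q\<^bsup>-x\<^esup>\<close> cancels the weight \<open>q\<^sup>x\<close> of the measure, so what remains is a sum
  of \<open>\<chi>(x) q\<^bsup>l x\<^esup>\<close>. Splitting it along residue classes modulo \<open>f\<close> leaves a geometric sum with limit
  \<open>l / [l f]\<^sub>q\<close> if \<open>l > 0\<close>, and \<open>p\<^sup>N / [f p\<^sup>N]\<^sub>q\<close> if \<open>l = 0\<close> (\<open>geometric_moment\<close>). The latter converges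
  because the logarithm is the limit of \<open>(q\<^bsup>p\<^sup>N\<^esup> - 1) / p\<^sup>N\<close> (\<open>power_tendsto_plog\<close>) and does not vanish
  at \<open>q\<close> (\<open>plog_nonzero\<close>): once \<open>q\<^bsup>p\<^sup>N\<^esup>\<close> is close to one, raising it to the power \<open>p\<close> multiplies the
  absolute value of \<open>q\<^bsup>p\<^sup>N\<^esup> - 1\<close> by exactly \<open>\<bar>p\<bar>\<close>, so the quotients stay away from zero unless
  \<open>q\<close> is a root of unity.

  The first formula is the result of this computation, as the sum over \<open>(a\<^sub>1, \<dots>, a\<^sub>r)\<close> factors into an
  \<open>r\<close>-th power. The second one compares it with the same computation for \<open>q\<^sup>f\<close> in place of \<open>q\<close>,
  without a character, where \<open>(q\<^sup>f)\<^bsup>(x + a) / f\<^esup> = q\<^sup>x q\<^sup>a\<close> and \<open>l / [l]\<close> formed with \<open>q\<^sup>f\<close> is \<open>[f]\<^sub>q\<close> times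
  \<open>l / [l f]\<^sub>q\<close>.

  Two tools carry the analysis: dominated convergence for series (\<open>padic_tannery\<close>) makes \<open>q\<^sup>x\<close>
  continuous in \<open>x\<close> and yields the logarithm, and the density of the natural numbers in \<open>\<int>\<^sub>p\<close>
  (\<open>Zp_iff\<close>) extends the laws of powers to \<open>p\<close>-adic exponents.
\<close>

section \<open>The ultrametric absolute value\<close>

context padic_complex
begin

lemma absp_eq_dist: "absp x = dist x 0"
  by (simp add: dist_absp)

lemma absp_nonneg [simp]: "absp x \<ge> 0"
  by (simp add: absp_eq_dist)

lemma absp_eq_0_iff [simp]: "absp x = 0 \<longleftrightarrow> x = 0"
  by (simp add: absp_eq_dist)

lemma absp_zero [simp]: "absp 0 = 0"
  by simp

lemma absp_pos_iff [simp]: "absp x > 0 \<longleftrightarrow> x \<noteq> 0"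
  by (simp add: absp_eq_dist)

lemma absp_one [simp]: "absp 1 = 1"
  using absp_mult[of 1 1] by simp

lemma absp_minus [simp]: "absp (- x) = absp x"
  using dist_absp[of 0 x] by (simp add: absp_eq_dist dist_commute)

lemma absp_minus_commute: "absp (x - y) = absp (y - x)"
  using absp_minus[of "x - y"] by simp

lemma absp_diff_le: "absp (x - y) \<le> max (absp x) (absp y)"
  using absp_ultrametric[of x "- y"] by simp

lemma absp_power [simp]: "absp (x ^ n) = absp x ^ n"
  by (induction n) (auto simp: absp_mult)

lemma absp_divide: "absp (x / y) = absp x / absp y"
proof (cases "y = 0")
  case False
  then have "absp (x / y) * absp y = absp x"
    by (simp flip: absp_mult)
  then show ?thesis
    using False by (simp add: field_simps)
qed simp

lemma absp_sum_le:
  assumes "\<And>i. i \<in> A \<Longrightarrow> absp (f i) \<le> B" "B \<ge> 0"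
  shows "absp (sum f A) \<le> B"
  using assms
proof (induction A rule: infinite_finite_induct)
  case (insert i A)
  then have "absp (f i + sum f A) \<le> max (absp (f i)) (absp (sum f A))"
    by (intro absp_ultrametric)
  also have "\<dots> \<le> B"
    using insert by auto
  finally show ?case
    using insert by simp
qed auto

lemma absp_of_nat_le_1 [simp]: "absp (of_nat n) \<le> 1"
proof (induction n)
  case (Suc n)
  then show ?case
    using absp_ultrametric[of 1 "of_nat n"] by simp
qed simp

lemma absp_of_int_le_1 [simp]: "absp (of_int a) \<le> 1"
  by (cases a rule: int_cases2) simp_all

text \<open>In \<open>x = (x - y) + y\<close> the second term dominates and cannot be cancelled.\<close>

lemma absp_eq_of_diff_less:
  assumes "absp (x - y) < absp y"
  shows "absp x = absp y"
proof -
  have "absp x \<le> max (absp (x - y)) (absp y)"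
    using absp_ultrametric[of "x - y" y] by simp
  moreover have "absp y \<le> max (absp x) (absp (x - y))"
    using absp_diff_le[of x "x - y"] by simp
  ultimately show ?thesis
    using assms by linarith
qed

lemma p_gt_1: "p > 1"
  using prime_p prime_gt_1_nat by blast

lemma absp_p_power: "absp (of_nat (p ^ N)) = 1 / real p ^ N"
  by (simp add: absp_p power_one_over)

lemma absp_of_int_le_of_dvd:
  assumes "int (p ^ N) dvd a"
  shows "absp (of_int a) \<le> 1 / real p ^ N"
proof -
  obtain c where "a = int (p ^ N) * c"
    using assms by (elim dvdE)
  then have "absp (of_int a) = absp (of_nat (p ^ N)) * absp (of_int c)"
    using absp_mult[of "of_nat (p ^ N)" "of_int c"] by simp
  also have "\<dots> \<le> absp (of_nat (p ^ N)) * 1"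
    by (intro mult_left_mono) auto
  finally show ?thesis
    by (simp only: absp_p_power mult_1_right)
qed

text \<open>A Bezout relation \<open>a u + p v = 1\<close> would force \<open>\<bar>1\<bar> < 1\<close> if \<open>\<bar>a\<bar> < 1\<close>.\<close>

lemma absp_of_int_coprime:
  assumes "coprime a (int p)"
  shows "absp (of_int a) = 1"
proof (rule ccontr)
  assume "absp (of_int a) \<noteq> 1"
  then have less: "absp (of_int a) < 1"
    using absp_of_int_le_1[of a] by linarith
  obtain u v where "u * a + v * int p = 1"
    using assms bezout_int[of a "int p"] by auto
  then have "(1 :: 'c) = of_int u * of_int a + of_int v * of_nat p"
    by (metis of_int_1 of_int_add of_int_mult of_int_of_nat_eq)
  then have "1 \<le> max (absp (of_int u * of_int a)) (absp (of_int v * of_nat p))"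
    using absp_ultrametric[of "of_int u * of_int a" "of_int v * of_nat p"] by simp
  moreover have "absp (of_int u * of_int a) < 1"
    using less mult_left_le_one_le[of "absp (of_int a)" "absp (of_int u)"]
      absp_mult[of "of_int u" "of_int a"] absp_of_int_le_1[of u] by (simp del: absp_of_int_le_1)
  moreover have "absp (of_int v * of_nat p) < 1"
  proof -
    have "absp (of_int v * of_nat p) \<le> 1 / real p"
      using mult_left_le_one_le[of "1 / real p" "absp (of_int v)"] by (simp add: absp_mult absp_p)
    also have "\<dots> < 1"
      using p_gt_1 by simp
    finally show ?thesis .
  qed
  ultimately show False
    by linarith
qed

lemma absp_of_nat_coprime:
  assumes "coprime f p"
  shows "absp (of_nat f) = 1"
  using absp_of_int_coprime[of "int f"] assms by simp

text \<open>
  The exact power of \<open>p\<close> dividing \<open>k\<close> is at most \<open>k\<close>. Hence the denominators in the logarithm series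
  grow at most linearly and the geometric factor wins.
\<close>

lemma absp_of_nat_ge:
  assumes "k > 0"
  shows "absp (of_nat k) \<ge> 1 / real k"
proof -
  obtain m where m: "k = p ^ multiplicity p k * m" "\<not> p dvd m"
    using multiplicity_decompose'[of k p] assms prime_p p_gt_1 by (metis less_irrefl neq0_conv nat_dvd_1_iff_1)
  have "coprime m p"
    using m(2) prime_p by (metis coprime_commute prime_imp_coprime)
  then have "absp (of_nat k) = 1 / real p ^ multiplicity p k"
    by (subst m(1)) (simp add: absp_mult absp_of_nat_coprime absp_p power_one_over)
  moreover have "p ^ multiplicity p k \<le> k"
    using assms by (intro dvd_imp_le multiplicity_dvd)
  then have "real p ^ multiplicity p k \<le> real k"
    by (metis of_nat_le_iff of_nat_power)
  ultimately show ?thesis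
    using assms p_gt_1 by (simp add: frac_le)
qed


section \<open>Limits and series\<close>

lemma tendsto_absp_iff:
  fixes X :: "'b \<Rightarrow> 'c"
  shows "(X \<longlongrightarrow> L) F \<longleftrightarrow> ((\<lambda>n. absp (X n - L)) \<longlongrightarrow> 0) F"
  by (subst tendsto_dist_iff) (simp add: dist_absp)

lemma padic_tendsto_add:
  fixes X Y :: "'b \<Rightarrow> 'c"
  assumes "(X \<longlongrightarrow> L) F" "(Y \<longlongrightarrow> M) F"
  shows "((\<lambda>n. X n + Y n) \<longlongrightarrow> L + M) F"
  unfolding tendsto_absp_iff
proof (rule Lim_null_comparison)
  show "\<forall>\<^sub>F n in F. norm (absp (X n + Y n - (L + M))) \<le> absp (X n - L) + absp (Y n - M)"
  proof (intro always_eventually allI)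
    fix n
    have "absp (X n + Y n - (L + M)) \<le> max (absp (X n - L)) (absp (Y n - M))"
      using absp_ultrametric[of "X n - L" "Y n - M"] by (simp add: add_diff_add)
    also have "\<dots> \<le> absp (X n - L) + absp (Y n - M)"
      by simp
    finally show "norm (absp (X n + Y n - (L + M))) \<le> absp (X n - L) + absp (Y n - M)"
      by simp
  qed
  show "((\<lambda>n. absp (X n - L) + absp (Y n - M)) \<longlongrightarrow> 0) F"
    using assms unfolding tendsto_absp_iff by (intro tendsto_add_zero)
qed

lemma padic_tendsto_cmult:
  fixes X :: "'b \<Rightarrow> 'c"
  assumes "(X \<longlongrightarrow> L) F"
  shows "((\<lambda>n. c * X n) \<longlongrightarrow> c * L) F"
  using tendsto_mult_right_zero[OF assms[unfolded tendsto_absp_iff], of "absp c"]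
  unfolding tendsto_absp_iff by (simp flip: absp_mult right_diff_distrib)

lemma padic_tendsto_mult:
  fixes X Y :: "'b \<Rightarrow> 'c"
  assumes "(X \<longlongrightarrow> L) F" "(Y \<longlongrightarrow> M) F"
  shows "((\<lambda>n. X n * Y n) \<longlongrightarrow> L * M) F"
proof -
  have "((\<lambda>n. absp (X n - L) * absp (Y n - M)) \<longlongrightarrow> 0) F"
    using assms unfolding tendsto_absp_iff by (rule tendsto_mult_zero)
  then have "((\<lambda>n. (X n - L) * (Y n - M)) \<longlongrightarrow> 0) F"
    by (simp add: tendsto_absp_iff absp_mult)
  then have "((\<lambda>n. (X n - L) * (Y n - M) + (L * Y n + M * X n) + - (L * M))
      \<longlongrightarrow> 0 + (L * M + M * L) + - (L * M)) F"
    by (intro padic_tendsto_add padic_tendsto_cmult tendsto_const assms)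
  then show ?thesis
    by (simp add: algebra_simps)
qed

lemma padic_tendsto_minus:
  fixes X :: "'b \<Rightarrow> 'c"
  assumes "(X \<longlongrightarrow> L) F"
  shows "((\<lambda>n. - X n) \<longlongrightarrow> - L) F"
  using padic_tendsto_cmult[OF assms, of "-1"] by simp

lemma padic_tendsto_diff:
  fixes X Y :: "'b \<Rightarrow> 'c"
  assumes "(X \<longlongrightarrow> L) F" "(Y \<longlongrightarrow> M) F"
  shows "((\<lambda>n. X n - Y n) \<longlongrightarrow> L - M) F"
  using padic_tendsto_add[OF assms(1) padic_tendsto_minus[OF assms(2)]] by simp

lemma padic_tendsto_sum:
  fixes X :: "'i \<Rightarrow> 'b \<Rightarrow> 'c"
  assumes "\<And>i. i \<in> A \<Longrightarrow> (X i \<longlongrightarrow> L i) F"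
  shows "((\<lambda>n. \<Sum>i\<in>A. X i n) \<longlongrightarrow> (\<Sum>i\<in>A. L i)) F"
  using assms by (induction A rule: infinite_finite_induct) (auto intro: padic_tendsto_add)

lemma padic_tendsto_prod:
  fixes X :: "'i \<Rightarrow> 'b \<Rightarrow> 'c"
  assumes "\<And>i. i \<in> A \<Longrightarrow> (X i \<longlongrightarrow> L i) F"
  shows "((\<lambda>n. \<Prod>i\<in>A. X i n) \<longlongrightarrow> (\<Prod>i\<in>A. L i)) F"
  using assms by (induction A rule: infinite_finite_induct) (auto intro: padic_tendsto_mult)

lemma padic_tendsto_power:
  fixes X :: "'b \<Rightarrow> 'c"
  assumes "(X \<longlongrightarrow> L) F"
  shows "((\<lambda>n. X n ^ k) \<longlongrightarrow> L ^ k) F"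
  by (induction k) (auto intro: padic_tendsto_mult assms)

lemma tendsto_absp:
  assumes "(X \<longlongrightarrow> L) F"
  shows "((\<lambda>n. absp (X n)) \<longlongrightarrow> absp L) F"
  unfolding absp_eq_dist by (intro tendsto_dist assms tendsto_const)

lemma padic_tendsto_inverse:
  fixes X :: "'b \<Rightarrow> 'c"
  assumes "(X \<longlongrightarrow> L) F" "L \<noteq> 0"
  shows "((\<lambda>n. inverse (X n)) \<longlongrightarrow> inverse L) F"
proof -
  have "((\<lambda>n. absp (X n - L) / (absp (X n) * absp L)) \<longlongrightarrow> 0 / (absp L * absp L)) F"
    using assms by (intro tendsto_divide tendsto_mult tendsto_const tendsto_absp)
      (auto simp: tendsto_absp_iff)
  moreover have "\<forall>\<^sub>F n in F. X n \<noteq> 0"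
    using assms by (rule tendsto_imp_eventually_ne)
  then have "\<forall>\<^sub>F n in F. absp (X n - L) / (absp (X n) * absp L) =
      absp (inverse (X n) - inverse L)"
  proof eventually_elim
    case (elim n)
    then have "inverse (X n) - inverse L = (L - X n) / (X n * L)"
      using assms by (simp add: field_simps)
    then show ?case
      by (simp add: absp_divide absp_mult absp_minus_commute)
  qed
  ultimately show ?thesis
    unfolding tendsto_absp_iff by (simp add: tendsto_cong)
qed

lemma absp_le_of_tendsto:
  assumes "X \<longlonglongrightarrow> L" "\<And>n. absp (X n) \<le> C"
  shows "absp L \<le> C"
  using tendsto_absp[OF assms(1)] assms(2) by (intro LIMSEQ_le_const2[of _ "absp L"]) auto

text \<open>
  In a complete ultrametric field a series converges as soon as its terms tend to zero, because
  every section of it is as small as its largest term.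
\<close>

lemma padic_summable:
  fixes a :: "nat \<Rightarrow> 'c"
  assumes "a \<longlonglongrightarrow> 0"
  shows "summable a"
  unfolding summable_iff_convergent
proof (rule Cauchy_convergent, rule metric_CauchyI)
  fix e :: real
  assume "e > 0"
  then obtain K where K: "\<And>k. k \<ge> K \<Longrightarrow> absp (a k) < e / 2"
    using metric_LIMSEQ_D[OF assms, of "e / 2"] by (auto simp: absp_eq_dist)
  have *: "absp (sum a {..<n} - sum a {..<m}) < e" if "K \<le> m" "m \<le> n" for m n
  proof -
    have "sum a {..<n} - sum a {..<m} = sum a {m..<n}"
      using that by (simp add: sum_diff_nat_ivl lessThan_atLeast0)
    also have "absp \<dots> \<le> e / 2"
      using K that \<open>e > 0\<close> by (intro absp_sum_le) (auto intro: less_imp_le)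
    finally show ?thesis
      using \<open>e > 0\<close> by simp
  qed
  show "\<exists>M. \<forall>m\<ge>M. \<forall>n\<ge>M. dist (sum a {..<m}) (sum a {..<n}) < e"
  proof (intro exI allI impI)
    fix m n
    assume "K \<le> m" "K \<le> n"
    then show "dist (sum a {..<m}) (sum a {..<n}) < e"
      using *[of m n] *[of n m] absp_minus_commute[of "sum a {..<m}" "sum a {..<n}"]
      by (cases "m \<le> n") (auto simp: dist_absp)
  qed
qed

lemma tendsto_zero_of_bound:
  assumes "\<And>k. absp (a k) \<le> M k" "M \<longlonglongrightarrow> 0"
  shows "a \<longlonglongrightarrow> 0"
proof -
  have "(\<lambda>k. absp (a k)) \<longlonglongrightarrow> 0"
    using assms by (intro Lim_null_comparison[OF _ assms(2)]) auto
  then show ?thesis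
    by (simp add: tendsto_absp_iff)
qed

text \<open>
  Dominated convergence for series. A dominating sequence that tends to zero suffices: beyond some
  index both series have small terms, and finitely many terms remain.
\<close>

lemma padic_tannery:
  assumes bound: "\<And>N k. absp (a N k) \<le> M k" and M: "M \<longlonglongrightarrow> 0"
    and lim: "\<And>k. (\<lambda>N. a N k) \<longlonglongrightarrow> b k"
  shows "(\<lambda>N. suminf (a N)) \<longlonglongrightarrow> suminf b"
proof -
  have bound': "absp (b k) \<le> M k" for k
    using lim bound by (rule absp_le_of_tendsto)
  have sums_a: "a N sums suminf (a N)" for N
    using bound M by (intro summable_sums padic_summable tendsto_zero_of_bound)
  have sums_b: "b sums suminf b"
    using bound' M by (intro summable_sums padic_summable tendsto_zero_of_bound)
  show ?thesis
  proof (rule metric_LIMSEQ_I)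
    fix e :: real
    assume "e > 0"
    then have e: "e / 2 > 0" by simp
    obtain K where K: "\<And>k. k \<ge> K \<Longrightarrow> M k < e / 2"
      using order_tendstoD(2)[OF M e] by (auto simp: eventually_sequentially)
    have "\<forall>\<^sub>F N in sequentially. \<forall>k\<in>{..<K}. dist (a N k) (b k) < e / 2"
      using lim e by (intro eventually_ball_finite ballI tendstoD) auto
    then obtain N0 where N0: "\<And>N k. N \<ge> N0 \<Longrightarrow> k < K \<Longrightarrow> absp (a N k - b k) < e / 2"
      by (auto simp: eventually_sequentially dist_absp)
    have "dist (suminf (a N)) (suminf b) < e" if "N \<ge> N0" for N
    proof -
      have small: "absp (a N k - b k) \<le> e / 2" for k
      proof (cases "k < K")
        case False
        then show ?thesis
          using K[of k] bound[of N k] bound'[of k] absp_diff_le[of "a N k" "b k"] by linarith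
      qed (use N0 that in \<open>auto intro: less_imp_le\<close>)
      have "(\<lambda>n. \<Sum>k<n. a N k - b k) \<longlonglongrightarrow> suminf (a N) - suminf b"
        using padic_tendsto_diff[OF sums_a[unfolded sums_def] sums_b[unfolded sums_def]]
        by (simp add: sum_subtractf)
      then have "absp (suminf (a N) - suminf b) \<le> e / 2"
        using small e by (elim absp_le_of_tendsto) (intro absp_sum_le, auto)
      then show ?thesis
        using \<open>e > 0\<close> by (simp add: dist_absp)
    qed
    then show "\<exists>N0. \<forall>N\<ge>N0. dist (suminf (a N)) (suminf b) < e"
      by blast
  qed
qed


section \<open>The \<open>p\<close>-adic integers as limits of natural numbers\<close>

lemma inverse_p_power_tendsto_0: "(\<lambda>N. 1 / real p ^ N) \<longlonglongrightarrow> 0"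
  using p_gt_1 by real_asymp

lemma p_power_tendsto_0: "(\<lambda>N. of_nat (p ^ N) :: 'c) \<longlonglongrightarrow> 0"
  using inverse_p_power_tendsto_0 by (simp only: tendsto_absp_iff diff_0_right absp_p_power)

text \<open>
  A rational number \<open>a / b\<close> of absolute value at most one has \<open>b\<close> prime to \<open>p\<close>; it is
  approximated by a solution \<open>m\<close> of \<open>b m \<equiv> a\<close> modulo a power of \<open>p\<close>.
\<close>

lemma rat_approx_nat:
  assumes "absp (of_rat r) \<le> 1"
  shows "\<exists>m::nat. absp (of_rat r - of_nat m) \<le> 1 / real p ^ N"
proof -
  obtain a b where ab: "quotient_of r = (a, b)"
    by fastforce
  have b: "b > 0" and cop: "coprime a b" and r: "r = of_int a / of_int b"
    using quotient_of_denom_pos[OF ab] quotient_of_coprime[OF ab] quotient_of_div[OF ab] by auto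
  have r': "(of_rat r :: 'c) = of_int a / of_int b"
    by (simp add: r of_rat_divide)
  have "\<not> int p dvd b"
  proof
    assume dvd: "int p dvd b"
    then have "absp (of_int b) \<le> 1 / real p"
      using absp_of_int_le_of_dvd[of 1 b] by simp
    then have "absp (of_int b) < 1"
      using p_gt_1 by (smt (verit) divide_less_eq_1 of_nat_1 of_nat_less_iff)
    moreover have "coprime a (int p)"
      using dvd cop by (meson coprime_divisors dvd_refl)
    then have "absp (of_int a) = 1"
      by (rule absp_of_int_coprime)
    moreover have "absp (of_int b) > 0"
      using b by simp
    ultimately show False
      using assms by (simp add: r' absp_divide)
  qed
  then have cop': "coprime b (int p)"
    using prime_p by (metis coprime_commute prime_imp_coprime prime_nat_int_transfer)
  then have "coprime b (int (p ^ N))"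
    by simp
  then obtain c where "[b * c = 1] (mod int (p ^ N))"
    using cong_solve_coprime_int by blast
  then have "[b * (a * c) = a] (mod int (p ^ N))"
    using cong_scalar_left[of "b * c" 1 _ a] by (simp add: mult_ac)
  define m where "m = nat ((a * c) mod int (p ^ N))"
  have m: "int m = (a * c) mod int (p ^ N)"
    using p_gt_1 by (simp add: m_def)
  have "[b * int m = a] (mod int (p ^ N))"
    using \<open>[b * (a * c) = a] (mod int (p ^ N))\<close> by (simp add: m cong_def mod_mult_right_eq)
  then have "absp (of_int (a - b * int m)) \<le> 1 / real p ^ N"
    by (intro absp_of_int_le_of_dvd) (metis cong_iff_dvd_diff cong_sym)
  moreover have "absp (of_rat r - of_nat m) = absp (of_int (a - b * int m))"
  proof -
    have "of_rat r - of_nat m = (of_int (a - b * int m) :: 'c) / of_int b"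
      using b by (simp add: r' field_simps)
    then show ?thesis
      using absp_of_int_coprime[OF cop'] by (simp add: absp_divide)
  qed
  ultimately show ?thesis
    by (intro exI[of _ m]) (simp only:)
qed

lemma Zp_iff: "x \<in> Zp absp \<longleftrightarrow> (\<exists>m. (\<lambda>i. of_nat (m i)) \<longlonglongrightarrow> x)"
proof
  assume x: "x \<in> Zp absp"
  have "\<exists>m::nat. absp (of_nat m - x) \<le> 1 / real p ^ N" for N
  proof -
    have pos: "1 / real p ^ N > 0"
      using p_gt_1 by simp
    have "x \<in> closure (range of_rat)"
      using x by (simp add: Zp_def Qp_def)
    then obtain r where r: "absp (of_rat r - x) < 1 / real p ^ N"
      using pos unfolding closure_approachable dist_absp by blast
    also have "1 / real p ^ N \<le> 1"
      using p_gt_1 by simp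
    finally have "absp (of_rat r) \<le> 1"
      using x absp_ultrametric[of "of_rat r - x" x] by (auto simp: Zp_def)
    then obtain m where "absp (of_rat r - of_nat m) \<le> 1 / real p ^ N"
      using rat_approx_nat by blast
    then have "absp (of_nat m - x) \<le> 1 / real p ^ N"
      using r absp_diff_le[of "of_rat r - x" "of_rat r - of_nat m"] by simp
    then show ?thesis ..
  qed
  then obtain m :: "nat \<Rightarrow> nat" where m: "\<And>N. absp (of_nat (m N) - x) \<le> 1 / real p ^ N"
    by metis
  have "(\<lambda>N. of_nat (m N) - x) \<longlonglongrightarrow> 0"
    using m inverse_p_power_tendsto_0 by (rule tendsto_zero_of_bound)
  then have "(\<lambda>N. of_nat (m N)) \<longlonglongrightarrow> x"
    using tendsto_absp_iff[of "\<lambda>N. of_nat (m N)" x] by (simp add: tendsto_absp_iff)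
  then show "\<exists>m. (\<lambda>i. of_nat (m i)) \<longlonglongrightarrow> x"
    by blast
next
  assume "\<exists>m. (\<lambda>i. of_nat (m i)) \<longlonglongrightarrow> x"
  then obtain m where m: "(\<lambda>i. of_nat (m i)) \<longlonglongrightarrow> x" ..
  then have "x \<in> Qp"
    unfolding Qp_def closure_sequential by (intro exI[of _ "\<lambda>i. of_nat (m i)"]) (metis of_rat_of_nat_eq rangeI)
  moreover have "absp x \<le> 1"
    using m by (rule absp_le_of_tendsto) simp
  ultimately show "x \<in> Zp absp"
    by (simp add: Zp_def)
qed

lemma Zp_limE:
  assumes "x \<in> Zp absp"
  obtains m where "(\<lambda>i. of_nat (m i)) \<longlonglongrightarrow> x"
  using assms Zp_iff by blast

lemma of_nat_Zp [simp]: "of_nat m \<in> Zp absp"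
  unfolding Zp_iff by (rule exI[of _ "\<lambda>_. m"]) simp

lemma Zp_add:
  assumes "x \<in> Zp absp" "y \<in> Zp absp"
  shows "x + y \<in> Zp absp"
proof -
  obtain k m where "(\<lambda>i. of_nat (k i)) \<longlonglongrightarrow> x" "(\<lambda>i. of_nat (m i)) \<longlonglongrightarrow> y"
    using assms by (elim Zp_limE)
  then have "(\<lambda>i. of_nat (k i + m i)) \<longlonglongrightarrow> x + y"
    by (simp add: padic_tendsto_add)
  then show ?thesis
    unfolding Zp_iff by (rule exI[of _ "\<lambda>i. k i + m i"])
qed

lemma Zp_mult:
  assumes "x \<in> Zp absp" "y \<in> Zp absp"
  shows "x * y \<in> Zp absp"
proof -
  obtain k m where "(\<lambda>i. of_nat (k i)) \<longlonglongrightarrow> x" "(\<lambda>i. of_nat (m i)) \<longlonglongrightarrow> y"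
    using assms by (elim Zp_limE)
  then have "(\<lambda>i. of_nat (k i * m i)) \<longlonglongrightarrow> x * y"
    by (simp add: padic_tendsto_mult)
  then show ?thesis
    unfolding Zp_iff by (rule exI[of _ "\<lambda>i. k i * m i"])
qed

lemma of_rat_Zp:
  assumes "absp (of_rat r) \<le> 1"
  shows "of_rat r \<in> Zp absp"
  using assms closure_subset[of "range of_rat"] by (auto simp: Zp_def Qp_def)

lemma Zp_minus:
  assumes "x \<in> Zp absp"
  shows "- x \<in> Zp absp"
  using Zp_mult[OF of_rat_Zp[of "- 1"] assms] by (simp add: of_rat_minus)

lemma Zp_divide_of_nat:
  assumes "x \<in> Zp absp" "coprime f p"
  shows "x / of_nat f \<in> Zp absp"
proof -
  have "absp (of_rat (1 / of_nat f)) \<le> 1"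
    using absp_of_nat_coprime[OF assms(2)] by (simp add: of_rat_divide absp_divide)
  then show ?thesis
    using Zp_mult[OF of_rat_Zp assms(1)] by (fastforce simp: of_rat_divide)
qed

lemma Zp_sum_list:
  assumes "set xs \<subseteq> Zp absp"
  shows "sum_list xs \<in> Zp absp"
  using assms of_nat_Zp[of 0] by (induction xs) (auto intro: Zp_add simp del: of_nat_Zp)

lemma gchoose_tendsto:
  fixes X :: "'b \<Rightarrow> 'c"
  assumes "(X \<longlongrightarrow> L) F"
  shows "((\<lambda>n. X n gchoose k) \<longlongrightarrow> L gchoose k) F"
proof -
  have "((\<lambda>n. inverse (fact k) * (\<Prod>i = 0..<k. X n - of_nat i)) \<longlongrightarrow>
      inverse (fact k) * (\<Prod>i = 0..<k. L - of_nat i)) F"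
    by (intro padic_tendsto_cmult padic_tendsto_prod padic_tendsto_diff assms tendsto_const)
  then show ?thesis
    by (simp add: gbinomial_prod_rev divide_inverse mult.commute)
qed

text \<open>Binomial coefficients of natural numbers are integers, and this passes to the limit.\<close>

lemma absp_gchoose_le_1:
  assumes "x \<in> Zp absp"
  shows "absp (x gchoose k) \<le> 1"
proof -
  obtain m where "(\<lambda>i. of_nat (m i)) \<longlonglongrightarrow> x"
    using assms by (rule Zp_limE)
  then have "(\<lambda>i. of_nat (m i) gchoose k) \<longlonglongrightarrow> x gchoose k"
    by (rule gchoose_tendsto)
  then show ?thesis
    by (rule absp_le_of_tendsto) (metis absp_of_nat_le_1 binomial_gbinomial)
qed


section \<open>The power \<open>q\<^sup>x\<close>\<close>

lemma qpow_of_nat [simp]: "qpow q (of_nat m) = (q :: 'c) ^ m"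
proof -
  have "qpow q (of_nat m) = (\<Sum>k\<le>m. (of_nat m gchoose k) * (q - 1) ^ k)"
    unfolding qpow_def
    by (rule suminf_finite) (auto simp: binomial_gbinomial[symmetric])
  also have "\<dots> = (\<Sum>k\<le>m. of_nat (m choose k) * (q - 1) ^ k * 1 ^ (m - k))"
    by (simp add: binomial_gbinomial)
  also have "\<dots> = (q - 1 + 1) ^ m"
    by (rule binomial_ring[symmetric])
  finally show ?thesis
    by simp
qed

lemma qpow_0 [simp]: "qpow (q :: 'c) 0 = 1"
  using qpow_of_nat[of q 0] by (simp del: qpow_of_nat)

lemma qpow_tendsto:
  assumes q: "absp (1 - q) < 1" and X: "X \<longlonglongrightarrow> x" "\<And>i. X i \<in> Zp absp"
  shows "(\<lambda>i. qpow q (X i)) \<longlonglongrightarrow> qpow q x"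
  unfolding qpow_def
proof (rule padic_tannery)
  fix i k
  have "absp (X i gchoose k) * absp (q - 1) ^ k \<le> 1 * absp (q - 1) ^ k"
    using X by (intro mult_right_mono absp_gchoose_le_1) auto
  then show "absp ((X i gchoose k) * (q - 1) ^ k) \<le> absp (q - 1) ^ k"
    by (simp add: absp_mult)
next
  show "(\<lambda>k. absp (q - 1) ^ k) \<longlonglongrightarrow> 0"
    using q by (intro LIMSEQ_realpow_zero) (auto simp: absp_minus_commute)
next
  fix k
  show "(\<lambda>i. (X i gchoose k) * (q - 1) ^ k) \<longlonglongrightarrow> (x gchoose k) * (q - 1) ^ k"
    using X by (intro padic_tendsto_mult gchoose_tendsto tendsto_const)
qed

text \<open>The functional equations hold for natural exponents, which are dense.\<close>

lemma qpow_add: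
  assumes q: "absp (1 - q) < 1" and "x \<in> Zp absp" "y \<in> Zp absp"
  shows "qpow q (x + y) = qpow q x * qpow q y"
proof -
  obtain k m where k: "(\<lambda>i. of_nat (k i)) \<longlonglongrightarrow> x" and m: "(\<lambda>i. of_nat (m i)) \<longlonglongrightarrow> y"
    using assms by (elim Zp_limE)
  have "(\<lambda>i. qpow q (of_nat (k i + m i))) \<longlonglongrightarrow> qpow q (x + y)"
    using q k m by (intro qpow_tendsto of_nat_Zp) (simp_all add: padic_tendsto_add)
  moreover have "(\<lambda>i. qpow q (of_nat (k i)) * qpow q (of_nat (m i))) \<longlonglongrightarrow> qpow q x * qpow q y"
    using q k m by (intro padic_tendsto_mult qpow_tendsto of_nat_Zp)
  then have "(\<lambda>i. qpow q (of_nat (k i + m i))) \<longlonglongrightarrow> qpow q x * qpow q y"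
    by (simp add: power_add del: of_nat_add)
  ultimately show ?thesis
    by (rule LIMSEQ_unique)
qed

lemma absp_one_minus_power_less:
  assumes "absp (1 - q) < 1"
  shows "absp (1 - q ^ f) < 1"
proof -
  have "absp q \<le> 1"
    using assms absp_diff_le[of 1 "1 - q"] by simp
  then have "absp (\<Sum>i<f. q ^ i) \<le> 1"
    by (intro absp_sum_le) (auto simp: power_le_one)
  then have "absp (1 - q) * absp (\<Sum>i<f. q ^ i) \<le> absp (1 - q) * 1"
    by (intro mult_left_mono) auto
  then show ?thesis
    using assms by (simp add: one_diff_power_eq absp_mult)
qed

lemma qpow_power_left:
  assumes q: "absp (1 - q) < 1" and "x \<in> Zp absp"
  shows "qpow (q ^ f) x = qpow q (of_nat f * x)"
proof -
  obtain m where m: "(\<lambda>i. of_nat (m i)) \<longlonglongrightarrow> x"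
    using assms by (elim Zp_limE)
  have "(\<lambda>i. qpow q (of_nat (f * m i))) \<longlonglongrightarrow> qpow q (of_nat f * x)"
    using q m by (intro qpow_tendsto of_nat_Zp) (simp_all add: padic_tendsto_cmult)
  moreover have "(\<lambda>i. qpow (q ^ f) (of_nat (m i))) \<longlonglongrightarrow> qpow (q ^ f) x"
    using q m by (intro qpow_tendsto of_nat_Zp absp_one_minus_power_less)
  then have "(\<lambda>i. qpow q (of_nat (f * m i))) \<longlonglongrightarrow> qpow (q ^ f) x"
    by (simp add: power_mult del: of_nat_mult)
  ultimately show ?thesis
    using LIMSEQ_unique by blast
qed

lemma qpow_minus:
  assumes "absp (1 - q) < 1" "x \<in> Zp absp"
  shows "qpow q (- x) * qpow q x = 1"
  using qpow_add[OF assms(1) Zp_minus[OF assms(2)] assms(2)] by simp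


section \<open>The logarithm as a derivative\<close>

text \<open>
  Since \<open>(h choose (k + 1)) / h = ((h - 1) choose k) / (k + 1)\<close>, the difference quotient of
  \<open>q\<^sup>h\<close> at \<open>h = 0\<close> is a series whose coefficients tend, as \<open>h = p\<^sup>N\<close> tends to zero, to the
  coefficients \<open>((-1) choose k) / (k + 1)\<close> of the logarithm.
\<close>

lemma power_minus_one_expansion:
  assumes "h > 0"
  shows "(q ^ h - 1) / of_nat h =
    (\<Sum>k. (of_nat (h - 1) gchoose k) * (q - 1) ^ Suc k / of_nat (Suc k) :: 'c)"
proof -
  have "(of_nat (h - 1) gchoose k) / of_nat (Suc k) = (of_nat (h choose Suc k) / of_nat h :: 'c)" for k
  proof -
    have "Suc k * (h choose Suc k) = h * ((h - 1) choose k)"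
      by (rule binomial_absorption)
    then have "(of_nat (Suc k) :: 'c) * of_nat (h choose Suc k) = of_nat h * of_nat ((h - 1) choose k)"
      by (metis of_nat_mult)
    moreover have "(of_nat (h - 1) gchoose k) = (of_nat ((h - 1) choose k) :: 'c)"
      by (rule binomial_gbinomial[symmetric])
    ultimately show ?thesis
      using assms by (simp add: frac_eq_eq mult_ac del: of_nat_Suc)
  qed
  then have "(\<Sum>k. (of_nat (h - 1) gchoose k) * (q - 1) ^ Suc k / of_nat (Suc k) :: 'c) =
      (\<Sum>k. of_nat (h choose Suc k) * (q - 1) ^ Suc k / of_nat h)"
    by (simp add: field_simps del: of_nat_Suc power_Suc)
  also have "\<dots> = (\<Sum>k<h. of_nat (h choose Suc k) * (q - 1) ^ Suc k / of_nat h)"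
    by (intro suminf_finite) auto
  also have "\<dots> = (\<Sum>k<h. of_nat (h choose Suc k) * (q - 1) ^ Suc k) / of_nat h"
    by (simp add: sum_divide_distrib)
  also have "(\<Sum>k<h. of_nat (h choose Suc k) * (q - 1) ^ Suc k) = q ^ h - 1"
    using binomial_ring[of "q - 1" 1 h] by (simp add: lessThan_Suc_atMost[symmetric] sum.lessThan_Suc_shift del: sum.lessThan_Suc power_Suc)
  finally show ?thesis
    by simp
qed

lemma power_tendsto_plog:
  assumes q: "absp (1 - q) < 1"
  shows "(\<lambda>N. (q ^ (p ^ N) - 1) / of_nat (p ^ N)) \<longlonglongrightarrow> plog q"
proof -
  have minus_one_gchoose: "(- 1 gchoose k) = ((- 1) ^ k :: 'c)" for k
    using gbinomial_minus[of "1 :: 'c" k] by (simp add: gbinomial_of_nat_symmetric flip: binomial_gbinomial)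
  have "(\<lambda>N. \<Sum>k. (of_nat (p ^ N - 1) gchoose k) * (q - 1) ^ Suc k / of_nat (Suc k))
      \<longlonglongrightarrow> (\<Sum>k. (- 1 gchoose k) * (q - 1) ^ Suc k / of_nat (Suc k))"
  proof (rule padic_tannery)
    fix N k
    have coeff: "absp (of_nat (p ^ N - 1) gchoose k) * absp (q - 1) ^ Suc k \<le> 1 * absp (q - 1) ^ Suc k"
      by (intro mult_right_mono absp_gchoose_le_1 of_nat_Zp zero_le_power absp_nonneg)
    have denom: "1 / absp (of_nat (Suc k)) \<le> real (Suc k)"
      using absp_of_nat_ge[of "Suc k"] by (simp add: field_simps del: of_nat_Suc)
    have "absp (of_nat (p ^ N - 1) gchoose k) * absp (q - 1) ^ Suc k *
        (1 / absp (of_nat (Suc k))) \<le> 1 * absp (q - 1) ^ Suc k * real (Suc k)"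
      by (rule mult_mono[OF coeff denom]) auto
    then show "absp ((of_nat (p ^ N - 1) gchoose k) * (q - 1) ^ Suc k / of_nat (Suc k)) \<le>
        real (Suc k) * absp (q - 1) ^ Suc k"
      by (simp add: absp_mult absp_divide mult_ac del: of_nat_Suc power_Suc)
  next
    have "(\<lambda>k. real k * absp (q - 1) ^ k) \<longlonglongrightarrow> 0"
      using q by (intro powser_times_n_limit_0) (auto simp: absp_minus_commute)
    then show "(\<lambda>k. real (Suc k) * absp (q - 1) ^ Suc k) \<longlonglongrightarrow> 0"
      by (rule LIMSEQ_Suc)
  next
    fix k
    have "(\<lambda>N. of_nat (p ^ N) - 1) \<longlonglongrightarrow> (0 - 1 :: 'c)"
      by (intro padic_tendsto_diff p_power_tendsto_0 tendsto_const)
    moreover have "(of_nat (p ^ N) - 1 :: 'c) = of_nat (p ^ N - 1)" for N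
      using p_gt_1 by (simp add: of_nat_diff Suc_le_eq)
    ultimately have "(\<lambda>N. of_nat (p ^ N - 1)) \<longlonglongrightarrow> (- 1 :: 'c)"
      by simp
    then show "(\<lambda>N. (of_nat (p ^ N - 1) gchoose k) * (q - 1) ^ Suc k / of_nat (Suc k))
        \<longlonglongrightarrow> (- 1 gchoose k) * (q - 1) ^ Suc k / of_nat (Suc k)"
      unfolding divide_inverse by (intro padic_tendsto_mult gchoose_tendsto tendsto_const)
  qed
  moreover have "(q ^ (p ^ N) - 1) / of_nat (p ^ N) =
      (\<Sum>k. (of_nat (p ^ N - 1) gchoose k) * (q - 1) ^ Suc k / of_nat (Suc k))" for N
    using p_gt_1 by (intro power_minus_one_expansion) simp
  ultimately show ?thesis
    by (simp only: plog_def minus_one_gchoose)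
qed

lemma power_p_power_tendsto_1:
  assumes q: "absp (1 - q) < 1"
  shows "(\<lambda>N. q ^ (p ^ N)) \<longlonglongrightarrow> 1"
proof -
  have "(\<lambda>N. of_nat (p ^ N) * ((q ^ (p ^ N) - 1) / of_nat (p ^ N)) + 1) \<longlonglongrightarrow> 0 * plog q + 1"
    by (intro padic_tendsto_add padic_tendsto_mult p_power_tendsto_0 power_tendsto_plog q tendsto_const)
  then show ?thesis
    using p_gt_1 by simp
qed

text \<open>In \<open>(1 + v)\<^sup>p - 1\<close> the linear term \<open>p v\<close> dominates once \<open>\<bar>v\<bar> < \<bar>p\<bar>\<close>.\<close>

lemma absp_power_p_minus_one:
  assumes "absp v < 1 / real p"
  shows "absp ((1 + v) ^ p - 1) = absp v / real p"
proof (cases "v = 0")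
  case False
  have less_1: "absp v < 1"
    using assms p_gt_1 by (smt (verit) divide_le_eq_1_pos of_nat_1 of_nat_less_iff)
  define R where "R = (\<Sum>k<p - 1. of_nat (p choose Suc (Suc k)) * v ^ k)"
  obtain m where m: "p = Suc m"
    using p_gt_1 by (cases p) auto
  have "(1 + v) ^ p = (\<Sum>k<Suc p. of_nat (p choose k) * v ^ k)"
    using binomial_ring[of v 1 p] by (simp add: lessThan_Suc_atMost add.commute)
  also have "\<dots> = 1 + of_nat p * v + v ^ 2 * R"
    unfolding R_def sum_distrib_left m
    by (simp only: sum.lessThan_Suc_shift) (simp add: power2_eq_square mult_ac)
  finally have expand: "(1 + v) ^ p - 1 - of_nat p * v = v ^ 2 * R"
    by simp
  have "absp R \<le> 1"
    unfolding R_def using less_1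
    by (intro absp_sum_le) (auto simp: absp_mult intro!: mult_le_one power_le_one)
  then have "absp (v ^ 2 * R) \<le> absp v * absp v * 1"
    unfolding absp_mult absp_power power2_eq_square by (intro mult_left_mono) auto
  also have "\<dots> < absp v * (1 / real p)"
    using mult_strict_left_mono[OF assms, of "absp v"] False by simp
  also have "\<dots> = absp (of_nat p * v)"
    by (simp add: absp_mult absp_p)
  finally have "absp ((1 + v) ^ p - 1 - of_nat p * v) < absp (of_nat p * v)"
    unfolding expand .
  from absp_eq_of_diff_less[OF this] show ?thesis
    by (simp add: absp_mult absp_p)
qed simp

text \<open>
  The quotients \<open>(q\<^bsup>p\<^sup>N\<^esup> - 1) / p\<^sup>N\<close> eventually have constant absolute value, so that
  their limit vanishes only if some \<open>q\<^bsup>p\<^sup>N\<^esup>\<close> equals one.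
\<close>

lemma plog_nonzero:
  assumes q: "absp (1 - q) < 1" and not_root: "\<And>m. m > 0 \<Longrightarrow> q ^ m \<noteq> 1"
  shows "plog q \<noteq> 0"
proof -
  have "(\<lambda>N. absp (q ^ (p ^ N) - 1)) \<longlonglongrightarrow> absp (1 - 1)"
    by (intro tendsto_absp padic_tendsto_diff power_p_power_tendsto_1 q tendsto_const)
  moreover have "1 / real p > 0"
    using p_gt_1 by simp
  ultimately obtain N where N: "absp (q ^ (p ^ N) - 1) < 1 / real p"
    by (metis (mono_tags, lifting) absp_zero diff_self eventually_sequentially order_refl order_tendstoD(2))
  define C where "C = absp (q ^ (p ^ N) - 1)"
  have C: "C > 0"
    unfolding C_def using not_root[of "p ^ N"] p_gt_1 by simp
  have const: "absp (q ^ (p ^ (N + j)) - 1) = C / real p ^ j" for j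
  proof (induction j)
    case (Suc j)
    have "C / real p ^ j \<le> C / 1"
      using p_gt_1 C by (intro divide_left_mono) auto
    then have "absp (q ^ (p ^ (N + j)) - 1) < 1 / real p"
      using Suc N by (simp add: C_def)
    from absp_power_p_minus_one[OF this] show ?case
      by (simp add: Suc flip: power_mult) (simp add: mult_ac)
  qed (simp add: C_def)
  have "(\<lambda>j. absp ((q ^ (p ^ (j + N)) - 1) / of_nat (p ^ (j + N)))) \<longlonglongrightarrow> absp (plog q)"
    using LIMSEQ_ignore_initial_segment[OF power_tendsto_plog[OF q]] by (rule tendsto_absp)
  moreover have "absp ((q ^ (p ^ (j + N)) - 1) / of_nat (p ^ (j + N))) = C * real p ^ N" for j
    using p_gt_1 const[of j]
    by (simp only: absp_divide absp_p_power add.commute[of j N]) (simp add: power_add field_simps)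
  ultimately have "absp (plog q) = C * real p ^ N"
    by (simp add: LIMSEQ_const_iff)
  then show ?thesis
    using C p_gt_1 by auto
qed

lemma plog_power:
  assumes q: "absp (1 - q) < 1"
  shows "plog (q ^ f) = of_nat f * plog q"
proof (rule LIMSEQ_unique)
  show "(\<lambda>N. ((q ^ f) ^ (p ^ N) - 1) / of_nat (p ^ N)) \<longlonglongrightarrow> plog (q ^ f)"
    by (intro power_tendsto_plog absp_one_minus_power_less q)
  have "(\<lambda>N. (\<Sum>i<f. (q ^ (p ^ N)) ^ i) * ((q ^ (p ^ N) - 1) / of_nat (p ^ N)))
      \<longlonglongrightarrow> (\<Sum>i<f. 1 ^ i) * plog q"
    by (intro padic_tendsto_mult padic_tendsto_sum padic_tendsto_power
        power_p_power_tendsto_1 power_tendsto_plog q)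
  moreover have "(\<Sum>i<f. (q ^ (p ^ N)) ^ i) * ((q ^ (p ^ N) - 1) / of_nat (p ^ N)) =
      ((q ^ f) ^ (p ^ N) - 1) / of_nat (p ^ N)" for N
    using power_diff_1_eq[of "q ^ (p ^ N)" f] by (simp add: mult_ac flip: power_mult)
  ultimately show "(\<lambda>N. ((q ^ f) ^ (p ^ N) - 1) / of_nat (p ^ N)) \<longlonglongrightarrow> of_nat f * plog q"
    by (simp only: power_one sum_constant card_lessThan mult_1_right)
qed

end


section \<open>Iterated integrals of sums of product functions\<close>

lemma tuples_0: "tuples 0 f = {[]}"
  by (auto simp: tuples_def)

lemma sum_tuples_Suc:
  "(\<Sum>as\<in>tuples (Suc r) f. h as) = (\<Sum>a<f. \<Sum>as\<in>tuples r f. h (a # as))"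
proof -
  have "tuples (Suc r) f = (\<lambda>(a, as). a # as) ` ({..<f} \<times> tuples r f)"
    by (auto simp: tuples_def length_Suc_conv image_iff)
  then have "(\<Sum>as\<in>tuples (Suc r) f. h as) =
      (\<Sum>z\<in>{..<f} \<times> tuples r f. h (case z of (a, as) \<Rightarrow> a # as))"
    by (simp add: sum.reindex inj_on_def split_def prod_eq_iff)
  also have "\<dots> = (\<Sum>a<f. \<Sum>as\<in>tuples r f. h (a # as))"
    by (simp add: sum.cartesian_product split_def)
  finally show ?thesis .
qed

lemma sum_tuples_prod:
  fixes b :: "nat \<Rightarrow> 'a::comm_semiring_1"
  shows "(\<Sum>as\<in>tuples r f. prod_list (map b as)) = (\<Sum>a<f. b a) ^ r"
proof (induction r)
  case (Suc r)
  then show ?case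
    by (simp add: sum_tuples_Suc sum_product flip: sum_distrib_left sum_distrib_right)
qed (simp add: tuples_0)

lemma prod_list_map_power_sum_list:
  fixes b :: "nat \<Rightarrow> 'a::comm_monoid_mult"
  shows "prod_list (map b as) * z ^ (l * sum_list as) = prod_list (map (\<lambda>a. b a * z ^ (l * a)) as)"
  by (induction as) (simp_all add: power_add algebra_simps)

context padic_complex
begin

text \<open>
  Integrating a function \<open>\<Sum>\<^sub>l c\<^sub>l \<Prod>\<^sub>i b\<^sub>l(x\<^sub>i)\<close> over one variable replaces the factor belonging
  to this variable by its integral \<open>I\<^sub>l\<close> and leaves a function of the same form. Of the functional
  \<open>S\<close> this uses linearity and the fact that it evaluates its argument within \<open>D\<close> only.
\<close>

lemma iter_integral_sum_of_products:
  fixes S :: "('a \<Rightarrow> 'c) \<Rightarrow> nat \<Rightarrow> 'c"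
  assumes local: "\<And>g h. (\<And>x. x \<in> D \<Longrightarrow> g x = h x) \<Longrightarrow> S g = S h"
    and linear: "\<And>c N. S (\<lambda>x. \<Sum>l\<le>n. c l * b l x) N = (\<Sum>l\<le>n. c l * S (b l) N)"
    and lim: "\<And>l. l \<le> n \<Longrightarrow> S (b l) \<longlonglongrightarrow> I l"
    and G: "\<And>xs. set xs \<subseteq> D \<Longrightarrow> length xs = r \<Longrightarrow>
      G xs = (\<Sum>l\<le>n. c l * prod_list (map (b l) xs))"
  shows "iter_integrable D S r G \<and> iter_integral S r G = (\<Sum>l\<le>n. c l * I l ^ r)"
  using G
proof (induction r arbitrary: G c)
  case 0
  then show ?case
    by simp
next
  case (Suc r)
  have inner: "iter_integrable D S r (\<lambda>xs. G (x # xs)) \<and>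
      iter_integral S r (\<lambda>xs. G (x # xs)) = (\<Sum>l\<le>n. c l * I l ^ r * b l x)" if "x \<in> D" for x
  proof -
    have "iter_integrable D S r (\<lambda>xs. G (x # xs)) \<and>
        iter_integral S r (\<lambda>xs. G (x # xs)) = (\<Sum>l\<le>n. (c l * b l x) * I l ^ r)"
      using that by (intro Suc.IH) (simp add: Suc.prems mult.assoc)
    then show ?thesis
      by (simp add: mult_ac)
  qed
  have "S (\<lambda>x. iter_integral S r (\<lambda>xs. G (x # xs))) = S (\<lambda>x. \<Sum>l\<le>n. c l * I l ^ r * b l x)"
    using inner by (intro local) blast
  also have "\<dots> = (\<lambda>N. \<Sum>l\<le>n. c l * I l ^ r * S (b l) N)"
    by (rule ext) (rule linear)
  also have "\<dots> \<longlonglongrightarrow> (\<Sum>l\<le>n. c l * I l ^ r * I l)"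
    by (intro padic_tendsto_sum padic_tendsto_cmult lim) simp
  finally have outer: "S (\<lambda>x. iter_integral S r (\<lambda>xs. G (x # xs))) \<longlonglongrightarrow>
      (\<Sum>l\<le>n. c l * I l ^ Suc r)"
    by (simp add: mult_ac)
  then show ?case
    using inner by (auto simp: convergent_def limI)
qed


section \<open>The integrals of the powers of \<open>q\<^sup>x\<close>\<close>

lemma qnum_of_nat: "qnum q (of_nat m) = (1 - q ^ m) / (1 - q :: 'c)"
  by (simp add: qnum_def)

text \<open>
  For \<open>u = q\<^bsup>f p\<^sup>N\<^esup> \<longrightarrow> 1\<close> the geometric sum is \<open>(1 - u\<^sup>l) / (1 - q\<^bsup>l f\<^esup>)\<close>, and
  \<open>(1 - u\<^sup>l) / (1 - u) \<longrightarrow> l\<close>. For \<open>l = 0\<close> the sum is \<open>p\<^sup>N\<close> and the logarithm appears.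
\<close>

lemma geometric_moment:
  assumes q: "absp (1 - q) < 1" and not_root: "\<And>m. m > 0 \<Longrightarrow> q ^ m \<noteq> 1" and f: "f > 0"
  shows "(\<lambda>N. 1 / qnum q (of_nat (f * p ^ N)) * (\<Sum>j<p ^ N. q ^ (l * f * j))) \<longlonglongrightarrow> qquot q f l"
proof -
  have p_pos: "p ^ N > 0" for N
    using p_gt_1 by simp
  have q1: "q \<noteq> 1"
    using not_root[of 1] by simp
  have u1: "q ^ (f * p ^ N) \<noteq> 1" for N
    using not_root[of "f * p ^ N"] f p_pos by simp
  have q_f: "absp (1 - q ^ f) < 1"
    using q by (rule absp_one_minus_power_less)
  show ?thesis
  proof (cases "l = 0")
    case True
    have plog_f: "plog (q ^ f) = of_nat f * plog q" "plog (q ^ f) \<noteq> 0"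
      using plog_power[OF q] plog_nonzero[OF q not_root] f by auto
    have "(\<lambda>N. (q - 1) * inverse (((q ^ f) ^ (p ^ N) - 1) / of_nat (p ^ N)))
        \<longlonglongrightarrow> (q - 1) * inverse (plog (q ^ f))"
      by (intro padic_tendsto_cmult padic_tendsto_inverse power_tendsto_plog q_f plog_f)
    moreover have "(q - 1) * inverse (((q ^ f) ^ (p ^ N) - 1) / of_nat (p ^ N)) =
        1 / qnum q (of_nat (f * p ^ N)) * (\<Sum>j<p ^ N. q ^ (l * f * j))" for N
    proof -
      have "1 / qnum q (of_nat (f * p ^ N)) = (q - 1) / (q ^ (f * p ^ N) - 1)"
        unfolding qnum_of_nat using minus_divide_divide[of "q - 1" "q ^ (f * p ^ N) - 1"] by simp
      then show ?thesis
        using True by (simp add: power_mult)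
    qed
    moreover have "(q - 1) * inverse (plog (q ^ f)) = qquot q f l"
      using True plog_f by (simp add: qquot_def divide_inverse)
    ultimately show ?thesis
      by (simp only:)
  next
    case False
    then have lf: "q ^ (l * f) \<noteq> 1"
      using not_root[of "l * f"] f by simp
    have "(\<lambda>N. (\<Sum>i<l. ((q ^ f) ^ (p ^ N)) ^ i) * ((1 - q) / (1 - q ^ (l * f))))
        \<longlonglongrightarrow> (\<Sum>i<l. 1 ^ i) * ((1 - q) / (1 - q ^ (l * f)))"
      by (intro padic_tendsto_mult padic_tendsto_sum padic_tendsto_power
          power_p_power_tendsto_1 q_f tendsto_const)
    moreover have "(\<Sum>i<l. ((q ^ f) ^ (p ^ N)) ^ i) * ((1 - q) / (1 - q ^ (l * f))) =
        1 / qnum q (of_nat (f * p ^ N)) * (\<Sum>j<p ^ N. q ^ (l * f * j))" for N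
    proof -
      define u where "u = q ^ (f * p ^ N)"
      have u: "u \<noteq> 1" "(q ^ f) ^ (p ^ N) = u"
        using u1 by (simp_all add: u_def power_mult)
      have "(\<Sum>j<p ^ N. q ^ (l * f * j)) = (\<Sum>j<p ^ N. (q ^ (l * f)) ^ j)"
        by (simp add: power_mult)
      also have "\<dots> = (1 - (q ^ (l * f)) ^ (p ^ N)) / (1 - q ^ (l * f))"
        using lf by (simp add: sum_gp_strict)
      also have "(q ^ (l * f)) ^ (p ^ N) = u ^ l"
        by (simp add: u_def mult_ac flip: power_mult)
      finally have "1 / qnum q (of_nat (f * p ^ N)) * (\<Sum>j<p ^ N. q ^ (l * f * j)) =
          (1 - q) / (1 - u) * ((1 - u ^ l) / (1 - q ^ (l * f)))"
        by (simp add: qnum_of_nat u_def del: of_nat_mult)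
      moreover have "(\<Sum>i<l. u ^ i) = (1 - u ^ l) / (1 - u)"
        using u by (simp add: sum_gp_strict)
      ultimately show ?thesis
        by (simp add: u)
    qed
    ultimately show ?thesis
      using False by (simp add: qquot_def qnum_of_nat del: of_nat_mult)
  qed
qed

lemma Zp_sums_qpow_tendsto:
  assumes q: "absp (1 - q) < 1" and not_root: "\<And>m. m > 0 \<Longrightarrow> q ^ m \<noteq> 1"
  shows "Zp_sums p q (\<lambda>x. qpow q (- x) * qpow q x ^ l) \<longlonglongrightarrow> qquot q 1 l"
proof -
  have "qpow q (- of_nat j) * (q ^ j) ^ l * q ^ j = q ^ (l * j)" for j
    using qpow_minus[OF q, of "of_nat j"] by (simp add: mult_ac flip: power_mult)
  then have "Zp_sums p q (\<lambda>x. qpow q (- x) * qpow q x ^ l) =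
      (\<lambda>N. 1 / qnum q (of_nat (1 * p ^ N)) * (\<Sum>j<p ^ N. q ^ (l * 1 * j)))"
    by (simp add: Zp_sums_def fun_eq_iff)
  then show ?thesis
    using geometric_moment[OF q not_root, of 1 l] by simp
qed

lemma sum_lessThan_mult:
  fixes h :: "nat \<Rightarrow> 'a::comm_monoid_add"
  shows "(\<Sum>x<f * M. h x) = (\<Sum>j<M. \<Sum>a<f. h (a + f * j))"
proof -
  have "(\<Sum>x<M * f. h x) = (\<Sum>j<M. \<Sum>x\<in>{j * f..<j * f + f}. h x)"
    by (rule sum.nat_group[symmetric])
  also have "\<dots> = (\<Sum>j<M. \<Sum>a<f. h (a + f * j))"
    using sum.shift_bounds_nat_ivl[of h 0 "_ * f" f]
    by (simp add: lessThan_atLeast0 mult.commute add.commute)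
  finally show ?thesis
    by (simp add: mult.commute)
qed

lemma X_to_Zp_of_nat [simp]:
  assumes "f > 0"
  shows "X_to_Zp (X_of_nat p f m) = (of_nat m :: 'c)"
proof -
  have "m < p ^ N" if "N \<ge> m" for N
    using that power_gt_expt[of p N] p_gt_1 by linarith
  moreover have "p ^ N \<le> f * p ^ N" for N
    using assms by simp
  ultimately have "\<forall>\<^sub>F N in sequentially. of_nat (X_of_nat p f m N) = (of_nat m :: 'c)"
    unfolding eventually_sequentially X_of_nat_def
    by (intro exI[of _ m] allI impI) (metis less_le_trans mod_less)
  then have "(\<lambda>N. of_nat (X_of_nat p f m N)) \<longlonglongrightarrow> (of_nat m :: 'c)"
    by (rule tendsto_eventually)
  then show ?thesis
    unfolding X_to_Zp_def by (rule limI)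
qed

lemma X_of_nat_in_X_space:
  assumes "f > 0"
  shows "X_of_nat p f m \<in> X_space p f"
  using assms p_gt_1 by (auto simp: X_space_def X_of_nat_def mod_mod_cancel)

text \<open>Consecutive residues differ by a multiple of \<open>p\<^sup>N\<close>, so their sequence converges.\<close>

lemma X_to_Zp_in_Zp:
  assumes "s \<in> X_space p f"
  shows "X_to_Zp s \<in> Zp absp"
proof -
  define d where "d N = (of_nat (s (Suc N)) - of_nat (s N) :: 'c)" for N
  have "absp (d N) \<le> 1 / real p ^ N" for N
  proof -
    have "s (Suc N) mod (f * p ^ N) = s N"
      using assms by (simp add: X_space_def)
    then have "int (s (Suc N)) - int (s N) = int (f * p ^ N) * int (s (Suc N) div (f * p ^ N))"
      using mult_div_mod_eq[of "f * p ^ N" "s (Suc N)"]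
      by (metis add_diff_cancel_right' of_nat_add of_nat_mult)
    then have "int (p ^ N) dvd int (s (Suc N)) - int (s N)"
      by simp
    from absp_of_int_le_of_dvd[OF this] show ?thesis
      by (simp add: d_def)
  qed
  then have "d \<longlonglongrightarrow> 0"
    using inverse_p_power_tendsto_0 by (rule tendsto_zero_of_bound)
  then have "d sums suminf d"
    by (intro summable_sums padic_summable)
  then have "(\<lambda>N. of_nat (s N) - of_nat (s 0)) \<longlonglongrightarrow> suminf d"
    using sum_lessThan_telescope[of "\<lambda>N. of_nat (s N) :: 'c"] by (simp add: sums_def d_def)
  then have "(\<lambda>N. of_nat (s N) - of_nat (s 0) + of_nat (s 0)) \<longlonglongrightarrow> suminf d + of_nat (s 0)"
    by (intro padic_tendsto_add tendsto_const)
  then have "(\<lambda>N. of_nat (s N)) \<longlonglongrightarrow> suminf d + of_nat (s 0)"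
    by simp
  then show ?thesis
    unfolding X_to_Zp_def Zp_iff using limI by metis
qed

text \<open>
  With \<open>x = a + f j\<close> the character depends on \<open>a\<close> only, and the sum over \<open>j\<close> is geometric.
\<close>

lemma X_sums_char_qpow_tendsto:
  assumes q: "absp (1 - q) < 1" and not_root: "\<And>m. m > 0 \<Longrightarrow> q ^ m \<noteq> 1" and f: "f > 0"
  shows "X_sums p f q (\<lambda>s. char_X chi s * (qpow q (- X_to_Zp s) * qpow q (X_to_Zp s) ^ l)) \<longlonglongrightarrow>
    (\<Sum>a<f. chi (int a) * q ^ (l * a)) * qquot q f l"
proof -
  have eq: "qpow q (- of_nat j) * ((q ^ j) ^ l * q ^ j) = q ^ (l * j)" for j
    using qpow_minus[OF q, of "of_nat j"] by (simp add: mult_ac flip: power_mult)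
  have char: "char_X chi (X_of_nat p f x) = chi (int (x mod f))" for x
    by (simp add: char_X_def X_of_nat_def)
  have "X_sums p f q (\<lambda>s. char_X chi s * (qpow q (- X_to_Zp s) * qpow q (X_to_Zp s) ^ l)) =
      (\<lambda>N. (\<Sum>a<f. chi (int a) * q ^ (l * a)) *
        (1 / qnum q (of_nat (f * p ^ N)) * (\<Sum>j<p ^ N. q ^ (l * f * j))))"
  proof
    fix N
    have "X_sums p f q (\<lambda>s. char_X chi s * (qpow q (- X_to_Zp s) * qpow q (X_to_Zp s) ^ l)) N =
        1 / qnum q (of_nat (f * p ^ N)) * (\<Sum>x<f * p ^ N. chi (int (x mod f)) * q ^ (l * x))"
      unfolding X_sums_def using f by (simp add: char eq mult.assoc del: of_nat_mult)
    also have "(\<Sum>x<f * p ^ N. chi (int (x mod f)) * q ^ (l * x)) =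
        (\<Sum>j<p ^ N. \<Sum>a<f. chi (int a) * q ^ (l * a) * q ^ (l * f * j))"
      unfolding sum_lessThan_mult by (simp add: algebra_simps power_add)
    also have "\<dots> = (\<Sum>a<f. chi (int a) * q ^ (l * a)) * (\<Sum>j<p ^ N. q ^ (l * f * j))"
      by (subst sum.swap) (simp add: sum_product)
    finally show "X_sums p f q (\<lambda>s. char_X chi s * (qpow q (- X_to_Zp s) * qpow q (X_to_Zp s) ^ l)) N =
        (\<Sum>a<f. chi (int a) * q ^ (l * a)) *
        (1 / qnum q (of_nat (f * p ^ N)) * (\<Sum>j<p ^ N. q ^ (l * f * j)))"
      by (simp add: mult_ac)
  qed
  then show ?thesis
    using geometric_moment[OF q not_root f, of l] by (simp only: padic_tendsto_cmult)
qed


section \<open>Explicit formulas for the \<open>q\<close>-Bernoulli polynomials\<close>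

lemma qnum_add_power_expansion:
  assumes q: "absp (1 - q) < 1" and "x \<in> Zp absp" "y \<in> Zp absp"
  shows "qnum q (x + y) ^ n =
    (\<Sum>l\<le>n. 1 / (1 - q) ^ n * of_nat (n choose l) * (- qpow q x) ^ l * qpow q y ^ l)"
proof -
  have "(1 - qpow q (x + y)) ^ n = (- qpow q x * qpow q y + 1) ^ n"
    by (simp add: qpow_add assms)
  also have "\<dots> = (\<Sum>l\<le>n. of_nat (n choose l) * ((- qpow q x) ^ l * qpow q y ^ l))"
    unfolding binomial_ring by (simp only: power_mult_distrib power_one mult_1_right)
  finally show ?thesis
    unfolding qnum_def power_divide by (simp add: sum_divide_distrib mult.assoc)
qed

text \<open>
  By the functional equation the integrands are sums of products of functions of one variable, as
  \<open>iter_integral_sum_of_products\<close> requires.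
\<close>

lemma qpow_sum_list_products:
  assumes q: "absp (1 - q) < 1" and "set xs \<subseteq> Zp absp"
  shows "prod_list (map (\<lambda>x. qpow q (- x) * qpow q x ^ l) xs) =
    qpow q (- sum_list xs) * qpow q (sum_list xs) ^ l"
  using assms(2)
proof (induction xs)
  case (Cons x xs)
  then have Zp: "x \<in> Zp absp" "sum_list xs \<in> Zp absp"
    by (auto intro: Zp_sum_list)
  have "qpow q (- x + - sum_list xs) = qpow q (- x) * qpow q (- sum_list xs)"
    by (intro qpow_add q Zp_minus Zp)
  then show ?case
    using Cons by (simp add: qpow_add[OF q Zp] power_mult_distrib mult_ac add.commute)
qed simp

lemma qbern_formula:
  assumes q: "absp (1 - q) < 1" and not_root: "\<And>m. m > 0 \<Longrightarrow> q ^ m \<noteq> 1" and x: "x \<in> Zp absp"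
  shows "qbern_exists absp p r n q x \<and> qbern p r n q x =
    (\<Sum>l\<le>n. 1 / (1 - q) ^ n * of_nat (n choose l) * (- qpow q x) ^ l * qquot q 1 l ^ r)"
  unfolding qbern_exists_def qbern_def
proof (rule iter_integral_sum_of_products[where b = "\<lambda>l x. qpow q (- x) * qpow q x ^ l"])
  show "Zp_sums p q g = Zp_sums p q h" if "\<And>x. x \<in> Zp absp \<Longrightarrow> g x = h x" for g h
    using that by (simp add: Zp_sums_def fun_eq_iff)
  show "Zp_sums p q (\<lambda>x. \<Sum>l\<le>n. c l * (qpow q (- x) * qpow q x ^ l)) N =
      (\<Sum>l\<le>n. c l * Zp_sums p q (\<lambda>x. qpow q (- x) * qpow q x ^ l) N)" for c N
    unfolding Zp_sums_def sum_distrib_right sum_distrib_left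
    by (subst sum.swap) (simp add: mult_ac)
  show "Zp_sums p q (\<lambda>x. qpow q (- x) * qpow q x ^ l) \<longlonglongrightarrow> qquot q 1 l" for l
    using q not_root by (rule Zp_sums_qpow_tendsto)
  fix xs :: "'c list"
  assume xs: "set xs \<subseteq> Zp absp"
  show "qbern_integrand q n x xs = (\<Sum>l\<le>n. 1 / (1 - q) ^ n * of_nat (n choose l) *
      (- qpow q x) ^ l * prod_list (map (\<lambda>x. qpow q (- x) * qpow q x ^ l) xs))"
    unfolding qbern_integrand_def qpow_sum_list_products[OF q xs]
      qnum_add_power_expansion[OF q x Zp_sum_list[OF xs]]
    by (simp add: sum_distrib_left mult_ac)
qed

lemma gen_qbern_formula:
  assumes q: "absp (1 - q) < 1" and not_root: "\<And>m. m > 0 \<Longrightarrow> q ^ m \<noteq> 1"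
    and f: "f > 0" and x: "x \<in> Zp absp"
  shows "gen_qbern_exists p f chi r n q x \<and> gen_qbern p f chi r n q x =
    (\<Sum>l\<le>n. 1 / (1 - q) ^ n * of_nat (n choose l) * (- qpow q x) ^ l *
      ((\<Sum>a<f. chi (int a) * q ^ (l * a)) * qquot q f l) ^ r)"
  unfolding gen_qbern_exists_def gen_qbern_def
proof (rule iter_integral_sum_of_products
    [where b = "\<lambda>l s. char_X chi s * (qpow q (- X_to_Zp s) * qpow q (X_to_Zp s) ^ l)"])
  show "X_sums p f q g = X_sums p f q h" if "\<And>s. s \<in> X_space p f \<Longrightarrow> g s = h s" for g h
    using that X_of_nat_in_X_space[OF f] by (simp add: X_sums_def fun_eq_iff)
  show "X_sums p f q (\<lambda>s. \<Sum>l\<le>n. c l *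
        (char_X chi s * (qpow q (- X_to_Zp s) * qpow q (X_to_Zp s) ^ l))) N =
      (\<Sum>l\<le>n. c l *
        X_sums p f q (\<lambda>s. char_X chi s * (qpow q (- X_to_Zp s) * qpow q (X_to_Zp s) ^ l)) N)" for c N
    unfolding X_sums_def sum_distrib_right sum_distrib_left
    by (subst sum.swap) (simp add: mult_ac)
  show "X_sums p f q (\<lambda>s. char_X chi s * (qpow q (- X_to_Zp s) * qpow q (X_to_Zp s) ^ l)) \<longlonglongrightarrow>
      (\<Sum>a<f. chi (int a) * q ^ (l * a)) * qquot q f l" for l
    using q not_root f by (rule X_sums_char_qpow_tendsto)
  fix ss :: "(nat \<Rightarrow> nat) list"
  assume "set ss \<subseteq> X_space p f"
  then have ss: "set (map X_to_Zp ss) \<subseteq> Zp absp"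
    using X_to_Zp_in_Zp by auto
  have products: "prod_list (map (\<lambda>s. char_X chi s * (qpow q (- X_to_Zp s) * qpow q (X_to_Zp s) ^ l)) ss)
      = prod_list (map (char_X chi) ss) *
        (qpow q (- sum_list (map X_to_Zp ss)) * qpow q (sum_list (map X_to_Zp ss)) ^ l)" for l
    unfolding qpow_sum_list_products[OF q ss, symmetric]
    by (induction ss) (simp_all add: mult_ac)
  show "gen_qbern_integrand chi q n x ss = (\<Sum>l\<le>n. 1 / (1 - q) ^ n * of_nat (n choose l) *
      (- qpow q x) ^ l *
      prod_list (map (\<lambda>s. char_X chi s * (qpow q (- X_to_Zp s) * qpow q (X_to_Zp s) ^ l)) ss))"
    unfolding gen_qbern_integrand_def products
      qnum_add_power_expansion[OF q x Zp_sum_list[OF ss]]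
    by (simp add: sum_distrib_left sum_distrib_right mult_ac)
qed

text \<open>Both sides are \<open>l (1 - q\<^sup>f) / (1 - q\<^bsup>f l\<^esup>)\<close>, with its limiting value at \<open>l = 0\<close>.\<close>

lemma qquot_power:
  assumes q: "absp (1 - q) < 1" and "q ^ f \<noteq> 1"
  shows "qquot (q ^ f) 1 l = qnum q (of_nat f) * qquot q f l"
proof -
  have "q \<noteq> 1"
    using assms(2) by auto
  then have "(1 - q ^ f) / (1 - q) * (q - 1) = q ^ f - 1"
    by (simp add: field_simps)
  then have "(q ^ f - 1) / D = (1 - q ^ f) / (1 - q) * ((q - 1) / D)" for D
    by (simp only: times_divide_eq_right)
  moreover have "(q ^ f) ^ l = q ^ (l * f)"
    by (simp add: mult.commute flip: power_mult)
  ultimately show ?thesis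
    using \<open>q \<noteq> 1\<close>
    by (simp add: qquot_def qnum_of_nat plog_power[OF q] del: of_nat_mult)
qed

end

theorem theorem3:
  fixes p f n r :: nat
    and absp :: "'c::{field_char_0, complete_space} \<Rightarrow> real"
    and q x :: 'c
    and chi :: "int \<Rightarrow> 'c"
  assumes "padic_complex p absp"
    and "absp (1 - q) < 1"
    and "\<And>m::nat. m > 0 \<Longrightarrow> q ^ m \<noteq> 1"
    and "primitive_char f chi"
    and "coprime f p"
    and "r \<ge> 1"
    and "x \<in> Zp absp"
  shows "gen_qbern_exists p f chi r n q x \<and>
    gen_qbern p f chi r n q x =
      1 / (1 - q) ^ n *
      (\<Sum>l\<le>n. of_nat (n choose l) * (- qpow q x) ^ l *
        (\<Sum>as\<in>tuples r f. prod_list (map (\<lambda>a. chi (int a)) as) *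
           q ^ (l * sum_list as) * qquot q f l ^ r)) \<and>
    (\<forall>as\<in>tuples r f. qbern_exists absp p r n (q ^ f) ((x + of_nat (sum_list as)) / of_nat f)) \<and>
    gen_qbern p f chi r n q x =
      qnum q (of_nat f) powi (int n - int r) *
      (\<Sum>as\<in>tuples r f. prod_list (map (\<lambda>a. chi (int a)) as) *
         qbern p r n (q ^ f) ((x + of_nat (sum_list as)) / of_nat f))"
proof -
  interpret padic_complex p absp
    by fact
  note q = \<open>absp (1 - q) < 1\<close> and x = \<open>x \<in> Zp absp\<close>
  note not_root = \<open>\<And>m::nat. m > 0 \<Longrightarrow> q ^ m \<noteq> 1\<close>
  have f: "f > 0"
    using \<open>primitive_char f chi\<close> by (simp add: primitive_char_def dirichlet_char_def)
  have q_f: "absp (1 - q ^ f) < 1" "\<And>m. m > 0 \<Longrightarrow> (q ^ f) ^ m \<noteq> 1"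
    using q not_root f by (simp_all add: absp_one_minus_power_less flip: power_mult)
  have q1: "q \<noteq> 1" and qf1: "q ^ f \<noteq> 1"
    using not_root[of 1] not_root[OF f] by simp_all
  define F where "F = qnum q (of_nat f)"
  have F: "F \<noteq> 0" "1 - q ^ f = F * (1 - q)"
    using q1 qf1 by (simp_all add: F_def qnum_of_nat)
  define chis where "chis as = prod_list (map (\<lambda>a. chi (int a)) as)" for as
  define y where "y as = (x + of_nat (sum_list as)) / of_nat f" for as
  have y: "y as \<in> Zp absp" for as
    unfolding y_def using x \<open>coprime f p\<close> by (intro Zp_divide_of_nat Zp_add of_nat_Zp)
  have qpow_y: "qpow (q ^ f) (y as) = qpow q x * q ^ sum_list as" for as
    using f by (simp add: qpow_power_left[OF q y]) (simp add: y_def qpow_add[OF q x])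
  note gen = gen_qbern_formula[OF q not_root f x, of chi r n]
  note bern = qbern_formula[OF q_f y, of r n]
  \<comment> \<open>The sum over the tuples is the \<open>r\<close>-th power of a character sum.\<close>
  have tuples: "((\<Sum>a<f. chi (int a) * q ^ (l * a)) * qquot q f l) ^ r =
      (\<Sum>as\<in>tuples r f. chis as * q ^ (l * sum_list as) * qquot q f l ^ r)" for l
    by (simp add: chis_def power_mult_distrib prod_list_map_power_sum_list sum_tuples_prod
        flip: sum_distrib_right)
  have first: "gen_qbern p f chi r n q x = 1 / (1 - q) ^ n *
      (\<Sum>l\<le>n. of_nat (n choose l) * (- qpow q x) ^ l *
        (\<Sum>as\<in>tuples r f. chis as * q ^ (l * sum_list as) * qquot q f l ^ r))"
    using gen by (simp add: tuples sum_distrib_left mult.assoc)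
  \<comment> \<open>As \<open>1 - q\<^sup>f = F (1 - q)\<close>, the denominator \<open>(1 - q\<^sup>f)\<^sup>n\<close> contributes \<open>F\<^bsup>-n\<^esup>\<close>;
    each of the \<open>r\<close> integrals in one variable for \<open>q\<^sup>f\<close> contributes \<open>F\<close>.\<close>
  have "F powi (int n - int r) * (\<Sum>as\<in>tuples r f. chis as * qbern p r n (q ^ f) (y as)) =
      (\<Sum>as\<in>tuples r f. \<Sum>l\<le>n. 1 / (1 - q) ^ n * of_nat (n choose l) * (- qpow q x) ^ l *
        (chis as * q ^ (l * sum_list as) * qquot q f l ^ r))"
  proof -
    have "F powi (int n - int r) * (chis as * (1 / (F * (1 - q)) ^ n * c *
        (- (qpow q x * q ^ sum_list as)) ^ l * (F * qquot q f l) ^ r)) =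
      1 / (1 - q) ^ n * c * (- qpow q x) ^ l * (chis as * q ^ (l * sum_list as) * qquot q f l ^ r)"
      for as l c
    proof -
      have "F powi (int n - int r) = F ^ n / F ^ r"
        using F by (simp add: power_int_diff)
      moreover have "(- (qpow q x * q ^ sum_list as)) ^ l = (- qpow q x) ^ l * q ^ (l * sum_list as)"
        by (simp add: mult.commute[of l] power_mult flip: power_mult_distrib)
      ultimately show ?thesis
        using F by (simp add: power_mult_distrib)
    qed
    moreover have "qbern p r n (q ^ f) (y as) = (\<Sum>l\<le>n. 1 / (F * (1 - q)) ^ n *
        of_nat (n choose l) * (- (qpow q x * q ^ sum_list as)) ^ l * (F * qquot q f l) ^ r)" for as
      using bern by (simp only: qpow_y qquot_power[OF q qf1] F_def[symmetric] F(2))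
    ultimately show ?thesis
      by (simp only: sum_distrib_left)
  qed
  also have "\<dots> = gen_qbern p f chi r n q x"
    unfolding first by (subst sum.swap) (simp add: sum_distrib_left mult.assoc)
  finally show ?thesis
    using gen bern first by (simp add: F_def chis_def y_def)
qed

end
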